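(* Let $(\bar x,\bar y)\in\mathrm{gph}\,S$. Suppose that $f$ is locally Lipschitz continuous and that the sets $\mathrm{gph}\,Y$ and $\mathrm{gph}\,\varPhi$ are closed. Assume furthermore that the generalized value function constraint qualification (GVFCQ) holds at $(\bar x,\bar y)$. Then for every $y^*\in\mathbb{R}^m$, $$D^*S(\bar x,\bar y)(y^* )\subset\bigcup_{(u^*,v^* ):\ u^*\in D^*\varPhi(\bar x,f(\bar x,\bar y))(-v^* )}\ \ \bigcup_{(a^*,b^* )\in D^*f(\bar x,\bar y)(v^* )}\left\{u^*+a^*+D^*Y(\bar x,\bar y)(y^*+b^* )\right\}.$$ If additionally $f$ is strictly differentiable, then for every $y^*\in\mathbb{R}^m$, $$D^*S(\bar x,\bar y)(y^* )\subset\bigcup_{(u^*,v^* ):\ u^*\in D^*\varPhi(\bar x,f(\bar x,\bar y))(-v^* )}\left\{u^*+\nabla_xf(\bar x,\bar y)^\top v^*+D^*Y(\bar x,\bar y)\left(y^*+\nabla_yf(\bar x,\bar y)^\top v^*\right)\right\}.$$ Here $u^*\in\mathbb{R}^n$, $v^*\in\mathbb{R}^q$, $a^*\in\mathbb{R}^n$, $b^*\in\mathbb{R}^m$.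
   Context: Setting: $f:\mathbb{R}^n\times\mathbb{R}^m\to\mathbb{R}^q$ ($q\ge2$), and $Y:\mathbb{R}^n\rightrightarrows\mathbb{R}^m$ is a set-valued mapping. For a nonempty $\Omega\subset\mathbb{R}^q$, $\mathrm{Eff}(\Omega;\mathbb{R}^q_+)$ is the set of $z\in\Omega$ with $\Omega\subset z+[(\mathbb{R}^q\setminus(-\mathbb{R}^q_+))\cup\{0\}]$, and $\mathrm{WEff}(\Omega;\mathbb{R}^q_+)$ is the set of $z\in\Omega$ with $\Omega\subset z+(\mathbb{R}^q\setminus(-\mathrm{int}\,\mathbb{R}^q_+))$. The frontier map $\varPhi:\mathbb{R}^n\rightrightarrows\mathbb{R}^q$ is either $\varPhi^E(x)=\mathrm{Eff}(f(x,Y(x));\mathbb{R}^q_+)$ or $\varPhi^W(x)=\mathrm{WEff}(f(x,Y(x));\mathbb{R}^q_+)$ (either choice, fixed), where $f(x,Y(x))=\{f(x,y):y\in Y(x)\}$. The solution map is $S(x)=\{y\in Y(x): f(x,y)\in\varPhi(x)\}$. For a set-valued mapping $\Upsilon$, $\mathrm{gph}\,\Upsilon=\{(x,y):y\in\Upsilon(x)\}$. GVFCQ at $(\bar x,\bar y)$: the set-valued mapping $\Psi:\mathbb{R}^n\times\mathbb{R}^q\rightrightarrows\mathbb{R}^n\times\mathbb{R}^m$, $$\Psi(u,v)=\{(x,y)\in\mathrm{gph}\,Y:\ (x+u,\ f(x,y)+v)\in\mathrm{gph}\,\varPhi\},$$ is calm at $(0,0,\bar x,\bar y)$. A mapping $\Upsilon$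 is calm at $(\bar s,\bar t)$ if there are neighborhoods $U$ of $\bar s$, $V$ of $\bar t$ and $l>0$ with $d(t,\Upsilon(\bar s))\le l\|s-\bar s\|$ for all $s\in U$ and $t\in V\cap\Upsilon(s)$. For a set $\Omega$ closed around $\bar x\in\Omega$, the Fréchet normal cone is $\widehat N(\bar x;\Omega)=\{x^*:\limsup_{x\to\bar x,\,x\in\Omega}\langle x^*,x-\bar x\rangle/\|x-\bar x\|\le0\}$, and the limiting normal cone $N(\bar x;\Omega)$ is the set of limits of sequences $x_k^*\in\widehat N(x_k;\Omega)$ with $x_k\to\bar x$, $x_k\in\Omega$. The coderivative of $\Upsilon$ at $(\bar x,\bar y)\in\mathrm{gph}\,\Upsilon$ is $D^*\Upsilon(\bar x,\bar y)(y^* )=\{x^*:(x^*,-y^* )\in N((\bar x,\bar y);\mathrm{gph}\,\Upsilon)\}$; for the single-valued $f$, $D^*f(\bar x,\bar y)(v^* )$ denotes its coderivative at the point $((\bar x,\bar y),f(\bar x,\bar y))$ of its graph. For a vector $a$ and a set $A$, $a+A=\{a+b:b\in A\}$. *)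

theory Defs
  imports "HOL-Analysis.Analysis"
begin

section \<open>Efficient and weakly efficient points\<close>

definition Rplus :: "(real ^ 'q) set" where
  "Rplus = {v. \<forall>i. 0 \<le> v $ i}"

definition Eff :: "(real ^ 'q) set \<Rightarrow> (real ^ 'q) set" where
  "Eff \<Omega> = {z \<in> \<Omega>. \<Omega> \<subseteq> (+) z ` ((UNIV - uminus ` Rplus) \<union> {0})}"

definition WEff :: "(real ^ 'q) set \<Rightarrow> (real ^ 'q) set" where
  "WEff \<Omega> = {z \<in> \<Omega>. \<Omega> \<subseteq> (+) z ` (UNIV - uminus ` interior Rplus)}"

text \<open>A set-valued mapping from \<open>'a\<close> to \<open>'b\<close> is a function \<open>'a \<Rightarrow> 'b set\<close>; its value may be empty.\<close>

definition frontierE ::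
    "((real ^ 'n) \<times> (real ^ 'm) \<Rightarrow> (real ^ 'q)) \<Rightarrow> (real ^ 'n \<Rightarrow> (real ^ 'm) set) \<Rightarrow> real ^ 'n \<Rightarrow> (real ^ 'q) set"
  where "frontierE f Y x = Eff ((\<lambda>y. f (x, y)) ` Y x)"

definition frontierW ::
    "((real ^ 'n) \<times> (real ^ 'm) \<Rightarrow> (real ^ 'q)) \<Rightarrow> (real ^ 'n \<Rightarrow> (real ^ 'm) set) \<Rightarrow> real ^ 'n \<Rightarrow> (real ^ 'q) set"
  where "frontierW f Y x = WEff ((\<lambda>y. f (x, y)) ` Y x)"

definition solution_map ::
    "('a \<times> 'b \<Rightarrow> 'c) \<Rightarrow> ('a \<Rightarrow> 'b set) \<Rightarrow> ('a \<Rightarrow> 'c set) \<Rightarrow> 'a \<Rightarrow> 'b set"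
  where "solution_map f Y \<Phi> x = {y \<in> Y x. f (x, y) \<in> \<Phi> x}"

section \<open>Variational analysis\<close>

definition gph :: "('a \<Rightarrow> 'b set) \<Rightarrow> ('a \<times> 'b) set" where
  "gph \<Upsilon> = {(x, y). y \<in> \<Upsilon> x}"

text \<open>The library sets \<open>infdist t {} = 0\<close>, whereas here the distance to the empty set is infinite;
  hence the explicit nonemptiness conjunct.\<close>

definition calm ::
    "('a::real_normed_vector \<Rightarrow> 'b::real_normed_vector set) \<Rightarrow> 'a \<Rightarrow> 'b \<Rightarrow> bool" where
  "calm \<Upsilon> s0 t0 \<longleftrightarrow>
     (\<exists>U V. open U \<and> s0 \<in> U \<and> open V \<and> t0 \<in> V \<and>
       (\<exists>l>0. \<forall>s\<in>U. \<forall>t \<in> V \<inter> \<Upsilon> s. \<Upsilon> s0 \<noteq> {} \<and> infdist t (\<Upsilon> s0) \<le> l * norm (s - s0)))"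

text \<open>The filter \<open>at x within \<Omega>\<close> excludes \<open>x\<close> itself. At an isolated point of \<open>\<Omega>\<close> it is trivial,
  the limes superior is \<open>-\<infinity>\<close>, and the cone is the whole space.\<close>

definition frechet_normal_cone :: "'a::euclidean_space \<Rightarrow> 'a set \<Rightarrow> 'a set" where
  "frechet_normal_cone x \<Omega> =
     {xs. Limsup (at x within \<Omega>) (\<lambda>z. ereal (inner xs (z - x) / norm (z - x))) \<le> 0}"

definition limiting_normal_cone :: "'a::euclidean_space \<Rightarrow> 'a set \<Rightarrow> 'a set" where
  "limiting_normal_cone x \<Omega> =
     {xs. \<exists>X Xs. (\<forall>k::nat. X k \<in> \<Omega> \<and> Xs k \<in> frechet_normal_cone (X k) \<Omega>) \<and>
                 X \<longlonglongrightarrow> x \<and> Xs \<longlonglongrightarrow> xs}"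

definition coderivative ::
    "('a::euclidean_space \<Rightarrow> 'b::euclidean_space set) \<Rightarrow> 'a \<Rightarrow> 'b \<Rightarrow> 'b \<Rightarrow> 'a set" where
  "coderivative \<Upsilon> x y ys = {xs. (xs, - ys) \<in> limiting_normal_cone (x, y) (gph \<Upsilon>)}"

definition fun_coderivative ::
    "('a::euclidean_space \<Rightarrow> 'b::euclidean_space) \<Rightarrow> 'a \<Rightarrow> 'b \<Rightarrow> 'a set" where
  "fun_coderivative g x = coderivative (\<lambda>z. {g z}) x (g x)"

definition locally_lipschitz :: "('a::metric_space \<Rightarrow> 'b::metric_space) \<Rightarrow> bool" where
  "locally_lipschitz g \<longleftrightarrow> (\<forall>x. \<exists>U L. open U \<and> x \<in> U \<and> L-lipschitz_on U g)"

definition strictly_differentiable_at ::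
    "('a::real_normed_vector \<Rightarrow> 'b::real_normed_vector) \<Rightarrow> 'a \<Rightarrow> bool" where
  "strictly_differentiable_at g x \<longleftrightarrow>
     (\<exists>A. bounded_linear A \<and>
       ((\<lambda>(w, z). (g w - g z - A (w - z)) /\<^sub>R norm (w - z)) \<longlongrightarrow> 0)
         (at (x, x) within {(w, z). w \<noteq> z}))"

section \<open>The generalized value function constraint qualification\<close>

definition GVFCQ ::
    "((real ^ 'n) \<times> (real ^ 'm) \<Rightarrow> (real ^ 'q)) \<Rightarrow> (real ^ 'n \<Rightarrow> (real ^ 'm) set) \<Rightarrow>
     (real ^ 'n \<Rightarrow> (real ^ 'q) set) \<Rightarrow> real ^ 'n \<Rightarrow> (real ^ 'm) \<Rightarrow> bool" where
  "GVFCQ f Y \<Phi> x0 y0 \<longleftrightarrow>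
     calm (\<lambda>(u, v). {(x, y) \<in> gph Y. (x + u, f (x, y) + v) \<in> gph \<Phi>}) (0, 0) (x0, y0)"

end

theory Submission
  imports Defs
begin

text \<open>
  Introduce independent copies of the variables: on the product of \<open>gph Y\<close>, the graph of \<open>f\<close>
  and \<open>gph \<Phi>\<close>, with points \<open>(z, (w, t), (u, v))\<close>, the graph of the solution map is the kernel of
  the linear map \<open>T (z, (w, t), (u, v)) = ((u - fst z, v - t), w - z)\<close>. The calmness
  hypothesis and the Lipschitz property of \<open>f\<close> bound the distance to this kernel by a multiple of
  \<open>norm (T p)\<close>, so a Frechet normal to the kernel yields a local minimum over the product, with
  \<open>norm (T p)\<close> as an exact penalty. Smoothing the norms and minimizing over a small ball
  produces Frechet normals to the product at nearby points; in the limit every limiting normal to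
  the kernel is a limiting normal to the product plus an element of the range of the adjoint
  of \<open>T\<close>, which decouples into the three coderivatives.
\<close>

section \<open>Frechet normals: epsilon-delta form and Fermat's rule\<close>

text \<open>Removes the limes superior and the quotient. At \<open>z = x\<close> both sides of the
  inequality vanish, so the base point need not be excluded and isolated points of
  \<open>\<Omega>\<close> need no separate treatment.\<close>

lemma frechet_normal_cone_iff:
  fixes x :: "'a::euclidean_space"
  shows "c \<in> frechet_normal_cone x \<Omega> \<longleftrightarrow>
    (\<forall>e>0. \<exists>d>0. \<forall>z\<in>\<Omega>. norm (z - x) < d \<longrightarrow> inner c (z - x) \<le> e * norm (z - x))"
proof -
  have "c \<in> frechet_normal_cone x \<Omega> \<longleftrightarrow>
    (\<forall>e>0. \<forall>\<^sub>F z in at x within \<Omega>. inner c (z - x) / norm (z - x) < e)"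
  proof
    assume L: "c \<in> frechet_normal_cone x \<Omega>"
    show "\<forall>e>0. \<forall>\<^sub>F z in at x within \<Omega>. inner c (z - x) / norm (z - x) < e"
    proof (intro allI impI)
      fix e :: real assume "e > 0"
      then have "ereal e > 0" by simp
      moreover have "\<forall>y>0. \<forall>\<^sub>F z in at x within \<Omega>. ereal (inner c (z - x) / norm (z - x)) < y"
        using L unfolding frechet_normal_cone_def mem_Collect_eq Limsup_le_iff .
      ultimately have "\<forall>\<^sub>F z in at x within \<Omega>. ereal (inner c (z - x) / norm (z - x)) < ereal e"
        by blast
      then show "\<forall>\<^sub>F z in at x within \<Omega>. inner c (z - x) / norm (z - x) < e"
        by simp
    qed
  next
    assume R: "\<forall>e>0. \<forall>\<^sub>F z in at x within \<Omega>. inner c (z - x) / norm (z - x) < e"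
    show "c \<in> frechet_normal_cone x \<Omega>"
      unfolding frechet_normal_cone_def mem_Collect_eq Limsup_le_iff
    proof (intro allI impI)
      fix y :: ereal assume "y > 0"
      then obtain e where e: "0 < ereal e" "ereal e < y" using ereal_dense2 by blast
      then have "\<forall>\<^sub>F z in at x within \<Omega>. inner c (z - x) / norm (z - x) < e" using R by simp
      then show "\<forall>\<^sub>F z in at x within \<Omega>. ereal (inner c (z - x) / norm (z - x)) < y"
        by eventually_elim (use e in \<open>metis less_ereal.simps(1) less_trans\<close>)
    qed
  qed
  also have "\<dots> \<longleftrightarrow> (\<forall>e>0. \<exists>d>0. \<forall>z\<in>\<Omega>. norm (z - x) < d \<longrightarrow> inner c (z - x) \<le> e * norm (z - x))"
    (is "?A \<longleftrightarrow> ?B")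
  proof
    assume A: ?A
    show ?B
    proof (intro allI impI)
      fix e :: real assume "e > 0"
      with A obtain d where "d > 0"
        and d: "\<And>z. z \<in> \<Omega> \<Longrightarrow> z \<noteq> x \<Longrightarrow> dist z x < d \<Longrightarrow> inner c (z - x) / norm (z - x) < e"
        unfolding eventually_at by metis
      have "inner c (z - x) \<le> e * norm (z - x)" if "z \<in> \<Omega>" "norm (z - x) < d" for z
      proof (cases "z = x")
        case False
        then show ?thesis using d[of z] that by (simp add: dist_norm pos_divide_less_eq)
      qed simp
      with \<open>d > 0\<close> show "\<exists>d>0. \<forall>z\<in>\<Omega>. norm (z - x) < d \<longrightarrow> inner c (z - x) \<le> e * norm (z - x)"
        by blast
    qed
  next
    assume B: ?B
    show ?A
    proof (intro allI impI)
      fix e :: real assume e: "e > 0"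
      with B obtain d where "d > 0"
        \<comment> \<open>Halving \<open>e\<close> makes room for the strict inequality demanded
          below.\<close>
        and d: "\<And>z. z \<in> \<Omega> \<Longrightarrow> norm (z - x) < d \<Longrightarrow> inner c (z - x) \<le> e / 2 * norm (z - x)"
        by (meson half_gt_zero)
      have "inner c (z - x) / norm (z - x) < e" if "z \<in> \<Omega>" "z \<noteq> x" "dist z x < d" for z
      proof -
        have "inner c (z - x) / norm (z - x) \<le> e / 2"
          using d[of z] that by (simp add: dist_norm divide_le_eq)
        then show ?thesis using e by linarith
      qed
      with \<open>d > 0\<close> show "\<forall>\<^sub>F z in at x within \<Omega>. inner c (z - x) / norm (z - x) < e"
        unfolding eventually_at by blast
    qed
  qed
  finally show ?thesis .
qed

text \<open>Fermat's rule for a constrained minimum: since \<open>G\<close> does not decrease on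
  \<open>A\<close> near \<open>p\<close>, its linear part is bounded below there by the error of the
  first-order expansion.\<close>

lemma frechet_normal_cone_local_min:
  fixes p :: "'a::euclidean_space"
  assumes "(G has_derivative (\<lambda>h. inner g h)) (at p)"
    and "r > 0" and min: "\<And>z. z \<in> A \<Longrightarrow> norm (z - p) < r \<Longrightarrow> G p \<le> G z"
  shows "- g \<in> frechet_normal_cone p A"
  unfolding frechet_normal_cone_iff
proof (intro allI impI)
  fix e :: real assume "e > 0"
  then obtain d where "d > 0"
    and d: "\<And>z. norm (z - p) < d \<Longrightarrow> norm (G z - G p - inner g (z - p)) \<le> e * norm (z - p)"
    using assms(1) unfolding has_derivative_at_alt by blast
  have "inner (- g) (z - p) \<le> e * norm (z - p)" if "z \<in> A" "norm (z - p) < min d r" for z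
    using d[of z] min[of z] that by simp
  then show "\<exists>d>0. \<forall>z\<in>A. norm (z - p) < d \<longrightarrow> inner (- g) (z - p) \<le> e * norm (z - p)"
    using \<open>d > 0\<close> \<open>r > 0\<close> by (intro exI[of _ "min d r"]) simp
qed

section \<open>Exact penalization with smoothed norms\<close>

lemma has_derivative_sqrt_norm_sq:
  fixes x :: "'a::euclidean_space"
  assumes "d > 0"
  shows "((\<lambda>x. sqrt ((norm x)\<^sup>2 + d\<^sup>2)) has_derivative
           (\<lambda>h. inner (x /\<^sub>R sqrt ((norm x)\<^sup>2 + d\<^sup>2)) h)) (at x)"
proof -
  have "(norm x)\<^sup>2 + d\<^sup>2 > 0" using assms by (simp add: add_nonneg_pos)
  then have "((\<lambda>x. sqrt (inner x x + d\<^sup>2)) has_derivative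
           (\<lambda>h. inner (x /\<^sub>R sqrt (inner x x + d\<^sup>2)) h)) (at x)"
    by (auto intro!: derivative_eq_intros simp: dot_square_norm inner_commute field_simps)
  then show ?thesis by (simp add: dot_square_norm)
qed

text \<open>Smoothed norms keep the Lipschitz constant 1 of the norm; this is what confines the
  multiplier \<open>q\<close> of \<open>fuzzy_multiplier\<close> to the unit ball, independently of
  \<open>d\<close>.\<close>

lemma norm_sqrt_norm_sq_gradient_le:
  fixes x :: "'a::euclidean_space"
  assumes "d > 0"
  shows "norm (x /\<^sub>R sqrt ((norm x)\<^sup>2 + d\<^sup>2)) \<le> 1"
proof -
  have "norm x \<le> sqrt ((norm x)\<^sup>2 + d\<^sup>2)" by (rule real_le_rsqrt) simp
  moreover have "0 < sqrt ((norm x)\<^sup>2 + d\<^sup>2)" using assms by (simp add: add_nonneg_pos)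
  ultimately show ?thesis by (simp add: divide_inverse_commute[symmetric])
qed

text \<open>The norms of the local inequality are smoothed to \<open>sqrt ((norm x)\<^sup>2 + d\<^sup>2)\<close>, and the added term
  \<open>(norm (p - a))\<^sup>2\<close> forces the minimizer of the smoothed function into the interior of the ball.\<close>

lemma fuzzy_multiplier:
  fixes T :: "'a::euclidean_space \<Rightarrow> 'b::euclidean_space"
  assumes "closed A" "a \<in> A" and T: "bounded_linear T" "T a = 0"
    and T': "\<And>x y. inner (T x) y = inner x (T' y)"
    and "0 < r" "0 \<le> e" "0 \<le> k" "0 < h"
    and loc: "\<And>p. p \<in> A \<Longrightarrow> norm (p - a) \<le> r \<Longrightarrow>
          inner c (p - a) \<le> e * norm (p - a) + k * norm (T p)"
  shows "\<exists>p\<in>A. \<exists>q. \<exists>\<nu>\<in>frechet_normal_cone p A.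
    norm (p - a) < h \<and> norm q \<le> 1 \<and> norm (\<nu> - (c - k *\<^sub>R T' q)) \<le> e + h"
proof -
  \<comment> \<open>The ball must stay where \<open>loc\<close> holds, and the gradient
    \<open>2 *\<^sub>R (p - a)\<close> of the quadratic term must have norm at most
    \<open>h\<close>.\<close>
  define s where "s = min r (h / 3)"
  have s: "0 < s" "s \<le> r" "s \<le> h / 3" using assms unfolding s_def by auto
  \<comment> \<open>Smoothing raises the value at \<open>a\<close> from 0 to
    \<open>(e + k) * d\<close>; this choice keeps it below \<open>s\<^sup>2\<close>, and the summand
    1 keeps the denominator positive when \<open>e\<close> and \<open>k\<close> vanish.\<close>
  define d where "d = s\<^sup>2 / (2 * (1 + e + k))"
  have d: "d > 0" using s assms unfolding d_def by simp
  define N :: "'a \<Rightarrow> real" where "N x = sqrt ((norm x)\<^sup>2 + d\<^sup>2)" for x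
  define M :: "'b \<Rightarrow> real" where "M x = sqrt ((norm x)\<^sup>2 + d\<^sup>2)" for x
  define G where "G p = inner (- c) (p - a) + e * N (p - a) + k * M (T p) + inner (p - a) (p - a)" for p
  have "continuous_on X T" for X using T(1) by (rule linear_continuous_on)
  then have contG: "continuous_on X G" for X
    unfolding G_def N_def M_def by (intro continuous_intros) auto
  have "compact (A \<inter> cball a s)" using \<open>closed A\<close> by (simp add: closed_Int_compact)
  then obtain p where p: "p \<in> A" "norm (p - a) \<le> s"
    and pmin: "\<And>z. z \<in> A \<Longrightarrow> norm (z - a) \<le> s \<Longrightarrow> G p \<le> G z"
    using continuous_attains_inf[OF _ _ contG, of "A \<inter> cball a s"] \<open>a \<in> A\<close> s
    by (force simp: dist_norm norm_minus_commute)
  have NM: "norm x \<le> N x" "norm y \<le> M y" for x y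
    unfolding N_def M_def by (simp_all add: real_le_rsqrt)
  \<comment> \<open>Comparison of the minimizer with \<open>a\<close>: by \<open>loc\<close> all
    terms of \<open>G p\<close> except the quadratic one have nonnegative sum, so the quadratic term
    alone is at most \<open>G a\<close>.\<close>
  have "G p \<le> G a" using pmin \<open>a \<in> A\<close> s by simp
  also have "G a = (e + k) * d" using d T(2) by (simp add: G_def N_def M_def algebra_simps)
  finally have "G p \<le> (e + k) * d" .
  moreover have "e * norm (p - a) \<le> e * N (p - a)" "k * norm (T p) \<le> k * M (T p)"
    using NM assms by (simp_all add: mult_left_mono)
  moreover have "inner c (p - a) \<le> e * norm (p - a) + k * norm (T p)"
    using loc p s by simp
  ultimately have "(norm (p - a))\<^sup>2 \<le> (e + k) * d"
    unfolding G_def by (simp add: dot_square_norm)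
  also have "\<dots> < s\<^sup>2"
  proof -
    have "(1 + e + k) * d = s\<^sup>2 / 2" unfolding d_def using assms by (simp add: field_simps)
    moreover have "s\<^sup>2 > 0" using s by simp
    ultimately show ?thesis using d unfolding distrib_right by linarith
  qed
  finally have ps: "norm (p - a) < s" using s by (simp add: power_less_imp_less_base)
  define u where "u = (p - a) /\<^sub>R N (p - a)"
  define q where "q = T p /\<^sub>R M (T p)"
  have uq: "norm u \<le> 1" "norm q \<le> 1"
    unfolding u_def q_def N_def M_def by (rule norm_sqrt_norm_sq_gradient_le[OF d])+
  \<comment> \<open>The gradient of \<open>G\<close> at \<open>p\<close>. Its negative differs from
    \<open>c - k *\<^sub>R T' q\<close> only by the terms in \<open>u\<close> and
    \<open>p - a\<close>, of norm at most \<open>e\<close> and \<open>h\<close>.\<close>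
  define g where "g = - c + e *\<^sub>R u + k *\<^sub>R T' q + 2 *\<^sub>R (p - a)"
  have dN: "((\<lambda>x. N (x - a)) has_derivative (\<lambda>h. inner u h)) (at p)"
    unfolding N_def u_def
    by (rule has_derivative_compose[where f = "\<lambda>x. x - a", OF _ has_derivative_sqrt_norm_sq[OF d]])
       (auto intro!: derivative_eq_intros)
  have dM: "((\<lambda>x. M (T x)) has_derivative (\<lambda>h. inner q (T h))) (at p)"
    unfolding M_def q_def
    by (rule has_derivative_compose[where f = T, OF _ has_derivative_sqrt_norm_sq[OF d]])
       (rule bounded_linear_imp_has_derivative[OF T(1)])
  have "(G has_derivative (\<lambda>h. inner g h)) (at p)"
    unfolding G_def g_def
    by (rule derivative_eq_intros dN dM refl)+
       (auto simp: fun_eq_iff inner_simps T' inner_commute[of q] inner_commute[of "T' q"]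
          inner_commute[of p] inner_commute[of a])
  then have "- g \<in> frechet_normal_cone p A"
  proof (rule frechet_normal_cone_local_min)
    show "0 < s - norm (p - a)" using ps by simp
    show "G p \<le> G z" if "z \<in> A" "norm (z - p) < s - norm (p - a)" for z
      using that pmin[of z] norm_triangle_ineq[of "z - p" "p - a"] by simp
  qed
  moreover have "norm (- g - (c - k *\<^sub>R T' q)) \<le> e + h"
  proof -
    have "- g - (c - k *\<^sub>R T' q) = - (e *\<^sub>R u + 2 *\<^sub>R (p - a))" by (simp add: g_def)
    then have "norm (- g - (c - k *\<^sub>R T' q)) \<le> e * norm u + 2 * norm (p - a)"
      using norm_triangle_ineq[of "e *\<^sub>R u" "2 *\<^sub>R (p - a)"] \<open>0 \<le> e\<close>
      by (simp only: norm_minus_cancel norm_scaleR abs_of_nonneg abs_numeral)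
    also have "\<dots> \<le> e * 1 + h" using uq ps s assms by (intro add_mono mult_left_mono) auto
    finally show ?thesis by simp
  qed
  moreover have "norm (p - a) < h" using ps s by linarith
  ultimately show ?thesis using p uq by blast
qed

section \<open>Limiting normals to the kernel of a linear map\<close>

text \<open>By \<open>subreg\<close> the constraint \<open>T p = 0\<close> can be traded for a
  penalty \<open>norm (T p)\<close>. Convergent normals are bounded, so one penalty weight serves
  all of them; the resulting multipliers lie in a fixed ball and converge along a
  subsequence.\<close>

theorem limiting_normal_cone_Int_kernel:
  fixes T :: "'a::euclidean_space \<Rightarrow> 'b::euclidean_space"
  assumes "closed A" and T: "bounded_linear T"
    and T': "\<And>x y. inner (T x) y = inner x (T' y)"
    and "0 < \<rho>" "0 \<le> l"
    and subreg: "\<And>p. p \<in> A \<Longrightarrow> norm (p - a) < \<rho> \<Longrightarrow> \<exists>p'\<in>A. T p' = 0 \<and> norm (p - p') \<le> l * norm (T p)"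
    and c: "c \<in> limiting_normal_cone a {p \<in> A. T p = 0}"
  shows "\<exists>q. c - T' q \<in> limiting_normal_cone a A"
proof -
  obtain X C where X: "\<And>k::nat. X k \<in> A" "\<And>k. T (X k) = 0" "X \<longlonglongrightarrow> a"
    and C: "\<And>k. C k \<in> frechet_normal_cone (X k) {p \<in> A. T p = 0}" "C \<longlonglongrightarrow> c"
    using c unfolding limiting_normal_cone_def by auto
  obtain B where B: "B > 0" "\<And>k. norm (C k) \<le> B"
    using convergent_imp_Bseq[of C] C(2) unfolding convergent_def Bseq_def by blast
  obtain b where b: "b > 0" "\<And>x. norm (T x) \<le> norm x * b"
    using bounded_linear.pos_bounded[OF T] by blast
  have T'lin: "linear T'"
    by (rule linearI; subst vector_eq_ldot[symmetric]; simp add: inner_add_right T'[symmetric])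
  \<comment> \<open>Moving from \<open>p\<close> to a kernel point \<open>p'\<close> changes the
    linear form \<open>C k\<close> by at most \<open>norm (C k) * norm (p - p')\<close>, hence by at
    most \<open>\<kappa> * norm (T p)\<close>.\<close>
  define \<kappa> where "\<kappa> = (B + 1) * l"
  have "\<kappa> \<ge> 0" using B \<open>0 \<le> l\<close> by (simp add: \<kappa>_def)
  have "\<forall>\<^sub>F k in sequentially. norm (X k - a) < \<rho> / 2"
    using tendstoD[OF X(3), of "\<rho> / 2"] \<open>0 < \<rho>\<close> by (simp add: dist_norm)
  have step: "\<exists>p\<in>A. \<exists>q. \<exists>\<nu>\<in>frechet_normal_cone p A.
      norm (p - X k) < h \<and> norm q \<le> 1 \<and> norm (\<nu> - (C k - \<kappa> *\<^sub>R T' q)) \<le> h + h"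
    if k: "norm (X k - a) < \<rho> / 2" and h: "0 < h" "h \<le> 1" for k and h :: real
  proof -
    have half: "m * (d / (2 * m)) = d / 2" if "0 < m" for m d :: real
      using that by simp
    have lb: "0 < 1 + l * b" using b \<open>0 \<le> l\<close> by (simp add: add_pos_nonneg)
    then have "0 < h / (1 + l * b)" using h by simp
    \<comment> \<open>The accuracy is divided by \<open>1 + l * b\<close> because replacing
      \<open>p\<close> by \<open>p'\<close> can enlarge the distance to \<open>X k\<close> by that
      factor.\<close>
    then obtain d where "d > 0" and d: "\<And>z. z \<in> A \<Longrightarrow> T z = 0 \<Longrightarrow> norm (z - X k) < d \<Longrightarrow>
        inner (C k) (z - X k) \<le> h / (1 + l * b) * norm (z - X k)"
      using C(1)[of k, unfolded frechet_normal_cone_iff] by (metis (mono_tags, lifting) mem_Collect_eq)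
    \<comment> \<open>The first bound keeps \<open>p\<close> within \<open>\<rho>\<close> of
      \<open>a\<close>, so that \<open>subreg\<close> applies; the second keeps \<open>p'\<close>
      within \<open>d / 2\<close> of \<open>X k\<close>.\<close>
    define r where "r = min (\<rho> / 3) (d / (2 * (1 + l * b)))"
    have "r > 0" using \<open>0 < \<rho>\<close> \<open>d > 0\<close> lb by (simp add: r_def)
    show ?thesis
    proof (rule fuzzy_multiplier[OF \<open>closed A\<close> X(1) T X(2) T' \<open>r > 0\<close> less_imp_le[OF h(1)] \<open>\<kappa> \<ge> 0\<close> h(1)])
      fix p assume p: "p \<in> A" "norm (p - X k) \<le> r"
      have "norm (p - a) < \<rho>"
        using k p \<open>0 < \<rho>\<close> norm_triangle_ineq[of "p - X k" "X k - a"] by (simp add: r_def)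
      then obtain p' where p': "p' \<in> A" "T p' = 0" "norm (p - p') \<le> l * norm (T p)"
        using subreg p by blast
      have "norm (T p) \<le> norm (p - X k) * b"
        using b(2)[of "p - X k"] X(2)[of k] by (simp add: linear_diff bounded_linear.linear[OF T])
      then have "l * norm (T p) \<le> l * (norm (p - X k) * b)"
        by (rule mult_left_mono) (rule \<open>0 \<le> l\<close>)
      then have "norm (p - p') \<le> l * b * norm (p - X k)"
        using p'(3) by (simp only: mult_ac)
      then have 1: "norm (p' - X k) \<le> (1 + l * b) * norm (p - X k)"
        using norm_triangle_ineq[of "p' - p" "p - X k"] by (simp add: norm_minus_commute algebra_simps)
      also have "\<dots> \<le> (1 + l * b) * r" using p lb by simp
      also have "\<dots> \<le> (1 + l * b) * (d / (2 * (1 + l * b)))"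
        using lb unfolding r_def by (intro mult_left_mono) auto
      also have "\<dots> = d / 2"
        using half[OF lb] .
      finally have "norm (p' - X k) < d" using \<open>d > 0\<close> by simp
      from d[OF p'(1,2) this]
      have "inner (C k) (p' - X k) \<le> h / (1 + l * b) * norm (p' - X k)" .
      also have "\<dots> \<le> h / (1 + l * b) * ((1 + l * b) * norm (p - X k))"
        using 1 h lb by (intro mult_left_mono) auto
      also have "\<dots> = h * norm (p - X k)" using lb by simp
      finally have 2: "inner (C k) (p' - X k) \<le> h * norm (p - X k)" .
      have "inner (C k) (p - p') \<le> norm (C k) * norm (p - p')" by (rule norm_cauchy_schwarz)
      also have "\<dots> \<le> (B + 1) * (l * norm (T p))"
        using B p' by (intro mult_mono) (auto intro: order_trans[of _ B])
      finally have "inner (C k) (p - p') \<le> \<kappa> * norm (T p)" by (simp add: \<kappa>_def)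
      with 2 show "inner (C k) (p - X k) \<le> h * norm (p - X k) + \<kappa> * norm (T p)"
        by (simp add: inner_diff_right)
    qed
  qed
  obtain K where K: "\<And>k. k \<ge> K \<Longrightarrow> norm (X k - a) < \<rho> / 2"
    using \<open>\<forall>\<^sub>F k in sequentially. norm (X k - a) < \<rho> / 2\<close> unfolding eventually_sequentially by blast
  define H where "H k = 1 / real (Suc k)" for k
  have H: "H \<longlonglongrightarrow> 0" unfolding H_def by (rule LIMSEQ_Suc[OF lim_1_over_n])
  \<comment> \<open>The shift by \<open>K\<close> puts every index in the range where
    \<open>step\<close> applies.\<close>
  have "\<forall>k. \<exists>p q \<nu>. p \<in> A \<and> \<nu> \<in> frechet_normal_cone p A \<and> norm (p - X (k + K)) < H k \<and> norm q \<le> 1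
      \<and> norm (\<nu> - (C (k + K) - \<kappa> *\<^sub>R T' q)) \<le> H k + H k"
  proof
    fix k
    have "0 < H k" "H k \<le> 1" by (simp_all add: H_def)
    from step[OF K this, of "k + K"]
    show "\<exists>p q \<nu>. p \<in> A \<and> \<nu> \<in> frechet_normal_cone p A \<and> norm (p - X (k + K)) < H k \<and> norm q \<le> 1
      \<and> norm (\<nu> - (C (k + K) - \<kappa> *\<^sub>R T' q)) \<le> H k + H k"
      by (metis le_add2)
  qed
  then obtain P Q V where P: "\<And>k. P k \<in> A" "\<And>k. V k \<in> frechet_normal_cone (P k) A"
    "\<And>k. norm (P k - X (k + K)) < H k" "\<And>k. norm (Q k) \<le> 1"
    "\<And>k. norm (V k - (C (k + K) - \<kappa> *\<^sub>R T' (Q k))) \<le> H k + H k"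
    by metis
  have "compact (cball (0::'b) 1)" by simp
  then obtain q s where s: "strict_mono s" and q: "(Q \<circ> s) \<longlonglongrightarrow> q"
    unfolding compact_def using P(4) by (metis mem_cball_0)
  have Pa: "P \<longlonglongrightarrow> a"
  proof -
    have "(\<lambda>k. P k - X (k + K)) \<longlonglongrightarrow> 0"
      by (rule Lim_null_comparison[OF _ H]) (intro always_eventually allI less_imp_le P(3))
    from tendsto_add[OF this LIMSEQ_ignore_initial_segment[OF X(3), of K]] show ?thesis by simp
  qed
  have "(\<lambda>k. V k - (C (k + K) - \<kappa> *\<^sub>R T' (Q k))) \<longlonglongrightarrow> 0"
    by (rule Lim_null_comparison[where g = "\<lambda>k. H k + H k"])
      (use tendsto_add[OF H H] P(5) in \<open>simp_all add: always_eventually\<close>)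
  then have V0: "(\<lambda>k. V (s k) - (C (s k + K) - \<kappa> *\<^sub>R T' (Q (s k)))) \<longlonglongrightarrow> 0"
    by (rule LIMSEQ_subseq_LIMSEQ[OF _ s, unfolded o_def])
  have "(\<lambda>k. T' (Q (s k))) \<longlonglongrightarrow> T' q"
    using isCont_tendsto_compose[OF linear_continuous_at q[unfolded o_def], of T'] T'lin
    by (simp add: linear_conv_bounded_linear)
  moreover have "(\<lambda>k. C (s k + K)) \<longlonglongrightarrow> c"
    using LIMSEQ_subseq_LIMSEQ[OF LIMSEQ_ignore_initial_segment[OF C(2), of K] s] by (simp add: o_def)
  ultimately have "(\<lambda>k. C (s k + K) - \<kappa> *\<^sub>R T' (Q (s k))) \<longlonglongrightarrow> c - \<kappa> *\<^sub>R T' q"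
    by (intro tendsto_intros)
  \<comment> \<open>The weight \<open>\<kappa>\<close> is absorbed into the multiplier by linearity
    of \<open>T'\<close>.\<close>
  from tendsto_add[OF V0 this] have "(V \<circ> s) \<longlonglongrightarrow> c - T' (\<kappa> *\<^sub>R q)"
    by (simp add: o_def linear_scale[OF T'lin])
  moreover have "(P \<circ> s) \<longlonglongrightarrow> a" using LIMSEQ_subseq_LIMSEQ[OF Pa s] .
  ultimately have "c - T' (\<kappa> *\<^sub>R q) \<in> limiting_normal_cone a A"
    unfolding limiting_normal_cone_def mem_Collect_eq using P(1,2)
    by (intro exI[of _ "P \<circ> s"] exI[of _ "V \<circ> s"]) auto
  then show ?thesis ..
qed

section \<open>Normals to products\<close>

text \<open>Freezing one component at its base point leaves the Frechet inequality of the other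
  factor.\<close>

lemma frechet_normal_cone_TimesD:
  assumes "(c, d) \<in> frechet_normal_cone (x, y) (A \<times> B)" "x \<in> A" "y \<in> B"
  shows "c \<in> frechet_normal_cone x A" "d \<in> frechet_normal_cone y B"
proof -
  have *: "\<exists>r>0. (\<forall>z\<in>A. norm (z - x) < r \<longrightarrow> inner c (z - x) \<le> e * norm (z - x)) \<and>
      (\<forall>z\<in>B. norm (z - y) < r \<longrightarrow> inner d (z - y) \<le> e * norm (z - y))" if "e > 0" for e
  proof -
    obtain r where r: "r > 0" "\<And>u v. u \<in> A \<Longrightarrow> v \<in> B \<Longrightarrow> norm (u - x, v - y) < r \<Longrightarrow>
        inner c (u - x) + inner d (v - y) \<le> e * norm (u - x, v - y)"
      using assms(1) \<open>e > 0\<close> unfolding frechet_normal_cone_iff by (force simp: inner_prod_def)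
    then show ?thesis using r(2)[of _ y] r(2)[of x] assms(2,3) by (force simp: norm_Pair)
  qed
  show "c \<in> frechet_normal_cone x A" "d \<in> frechet_normal_cone y B"
    unfolding frechet_normal_cone_iff using * by blast+
qed

lemma limiting_normal_cone_TimesD:
  assumes "(c, d) \<in> limiting_normal_cone (x, y) (A \<times> B)"
  shows "c \<in> limiting_normal_cone x A" "d \<in> limiting_normal_cone y B"
proof -
  obtain X C where XC: "\<And>k::nat. X k \<in> A \<times> B" "\<And>k. C k \<in> frechet_normal_cone (X k) (A \<times> B)"
    "X \<longlonglongrightarrow> (x, y)" "C \<longlonglongrightarrow> (c, d)"
    using assms unfolding limiting_normal_cone_def by blast
  have *: "fst (C k) \<in> frechet_normal_cone (fst (X k)) A" "snd (C k) \<in> frechet_normal_cone (snd (X k)) B" for k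
    using frechet_normal_cone_TimesD[of "fst (C k)" "snd (C k)" "fst (X k)" "snd (X k)" A B] XC(1,2)[of k]
    by (auto simp: mem_Times_iff)
  show "c \<in> limiting_normal_cone x A"
    unfolding limiting_normal_cone_def mem_Collect_eq
    using XC(1) *(1) tendsto_fst[OF XC(3)] tendsto_fst[OF XC(4)]
    by (intro exI[of _ "\<lambda>k. fst (X k)"] exI[of _ "\<lambda>k. fst (C k)"]) (auto simp: mem_Times_iff)
  show "d \<in> limiting_normal_cone y B"
    unfolding limiting_normal_cone_def mem_Collect_eq
    using XC(1) *(2) tendsto_snd[OF XC(3)] tendsto_snd[OF XC(4)]
    by (intro exI[of _ "\<lambda>k. snd (X k)"] exI[of _ "\<lambda>k. snd (C k)"]) (auto simp: mem_Times_iff)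
qed

section \<open>Strict differentiability and the coderivative of a function\<close>

lemma strictly_differentiable_at_estimate:
  assumes "((\<lambda>(w, z). (g w - g z - A (w - z)) /\<^sub>R norm (w - z)) \<longlongrightarrow> 0)
         (at (x, x) within {(w, z). w \<noteq> z})" "linear A" "e > 0"
  shows "\<exists>d>0. \<forall>w z. norm (w - x) < d \<longrightarrow> norm (z - x) < d \<longrightarrow>
           norm (g w - g z - A (w - z)) \<le> e * norm (w - z)"
proof -
  obtain d where "d > 0" and d: "\<And>w z. w \<noteq> z \<Longrightarrow> dist (w, z) (x, x) < d \<Longrightarrow>
      norm ((g w - g z - A (w - z)) /\<^sub>R norm (w - z)) < e"
    using tendstoD[OF assms(1,3)] unfolding eventually_at by (fastforce simp: dist_norm)
  have "norm (g w - g z - A (w - z)) \<le> e * norm (w - z)"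
    if "norm (w - x) < d / 2" "norm (z - x) < d / 2" for w z
  proof (cases "w = z")
    case True
    then show ?thesis using linear_0[OF assms(2)] by simp
  next
    case False
    have "dist (w, z) (x, x) < d"
      using that norm_Pair_le[of "w - x" "z - x"] by (simp add: dist_norm)
    from d[OF False this] False show ?thesis
      by (simp add: divide_inverse_commute[symmetric] divide_less_eq)
  qed
  then show ?thesis using \<open>d > 0\<close> by (intro exI[of _ "d / 2"]) auto
qed

text \<open>A Frechet normal \<open>(P, - V)\<close> to the graph at a point near
  \<open>(x, g x)\<close> satisfies \<open>P = A' V\<close> up to a small error, because strict
  differentiability lets the same \<open>A\<close> approximate increments of \<open>g\<close> from
  every nearby base point. The error vanishes in the limit.\<close>

lemma fun_coderivative_strictly_differentiable:
  fixes g :: "'a::euclidean_space \<Rightarrow> 'b::euclidean_space"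
  assumes lim: "((\<lambda>(w, z). (g w - g z - A (w - z)) /\<^sub>R norm (w - z)) \<longlongrightarrow> 0)
         (at (x, x) within {(w, z). w \<noteq> z})"
    and A: "bounded_linear A" and A': "\<And>u w. inner (A u) w = inner u (A' w)"
    and a: "a \<in> fun_coderivative g x v"
  shows "a = A' v"
proof -
  have A'lin: "linear A'"
    by (rule linearI; subst vector_eq_ldot[symmetric]; simp add: inner_add_right A'[symmetric])
  have linA: "linear A" using A by (rule bounded_linear.linear)
  obtain b where b: "b > 0" "\<And>u. norm (A u) \<le> norm u * b"
    using bounded_linear.pos_bounded[OF A] by blast
  obtain X C where X: "\<And>k::nat. X k \<in> gph (\<lambda>z. {g z})" "X \<longlonglongrightarrow> (x, g x)"
    and C: "\<And>k. C k \<in> frechet_normal_cone (X k) (gph (\<lambda>z. {g z}))" "C \<longlonglongrightarrow> (a, - v)"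
    using a unfolding fun_coderivative_def coderivative_def limiting_normal_cone_def by blast
  \<comment> \<open>The sign of \<open>V\<close> undoes the minus in the definition of the
    coderivative.\<close>
  define Z P V where "Z k = fst (X k)" and "P k = fst (C k)" and "V k = - snd (C k)" for k
  have X': "X k = (Z k, g (Z k))" for k
    using X(1)[of k] by (auto simp: gph_def Z_def)
  have C': "C k = (P k, - V k)" for k by (simp add: P_def V_def)
  have defs: "Z = (\<lambda>k. fst (X k))" "P = (\<lambda>k. fst (C k))" "V = (\<lambda>k. - snd (C k))"
    by (auto simp: Z_def P_def V_def)
  have lims: "Z \<longlonglongrightarrow> x" "P \<longlonglongrightarrow> a" "V \<longlonglongrightarrow> v"
    using tendsto_fst[OF X(2)] tendsto_fst[OF C(2)] tendsto_minus[OF tendsto_snd[OF C(2)]]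
    by (simp_all add: defs)
  have bound: "norm (a - A' v) \<le> e * (2 + b + norm v)" if e: "0 < e" "e \<le> 1" for e
  proof -
    obtain d where "d > 0" and d: "\<And>w z. norm (w - x) < d \<Longrightarrow> norm (z - x) < d \<Longrightarrow>
           norm (g w - g z - A (w - z)) \<le> e * norm (w - z)"
      using strictly_differentiable_at_estimate[OF lim linA e(1)] by blast
    have ev: "\<forall>\<^sub>F k in sequentially. norm (Z k - x) < d"
      using tendstoD[OF lims(1) \<open>d > 0\<close>] by (simp add: dist_norm)
    have "norm (P k - A' (V k)) \<le> e * (2 + b + norm (V k))" if k: "norm (Z k - x) < d" for k
    proof -
      define y where "y = P k - A' (V k)"
      obtain r where "r > 0" and r: "\<And>w. norm ((w, g w) - X k) < r \<Longrightarrow>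
          inner (C k) ((w, g w) - X k) \<le> e * norm ((w, g w) - X k)"
        using C(1)[of k] e(1) unfolding frechet_normal_cone_iff by (force simp: gph_def)
      \<comment> \<open>The Frechet inequality is tested along the direction \<open>y\<close> itself.\<close>
      define m where "m = min (d - norm (Z k - x)) (r / (2 + b))"
      have m: "m > 0" using k \<open>r > 0\<close> b by (simp add: m_def)
      \<comment> \<open>The summand 1 covers \<open>y = 0\<close> and makes
        \<open>s * norm y < m\<close> strict.\<close>
      define s where "s = m / (1 + norm y)"
      have s: "s > 0" "s * norm y < m"
        using m by (simp_all add: s_def divide_simps add_pos_nonneg add_nonneg_eq_0_iff)
      define w where "w = Z k + s *\<^sub>R y"
      have wZ: "w - Z k = s *\<^sub>R y" "norm (w - Z k) = s * norm y" using s by (simp_all add: w_def)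
      define R where "R = g w - g (Z k) - A (w - Z k)"
      have "norm (w - x) < d"
        using wZ(2) s(2) norm_triangle_ineq[of "w - Z k" "Z k - x"] unfolding m_def by simp
      from d[OF this k] have R: "norm R \<le> e * norm (w - Z k)" unfolding R_def .
      \<comment> \<open>Here \<open>e \<le> 1\<close> enters. The factor \<open>2 + b\<close> below
        collects 1 for the argument, 1 for the remainder \<open>R\<close> and \<open>b\<close> for
        \<open>A\<close>.\<close>
      also have "\<dots> \<le> norm (w - Z k)" using e by (simp add: mult_left_le_one_le)
      finally have "norm (g w - g (Z k)) \<le> norm (w - Z k) + norm (w - Z k) * b"
        using b(2)[of "w - Z k"] norm_triangle_ineq[of R "A (w - Z k)"] by (simp add: R_def)
      then have full: "norm ((w, g w) - X k) \<le> (2 + b) * norm (w - Z k)"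
        using norm_Pair_le[of "w - Z k" "g w - g (Z k)"] by (simp add: X' algebra_simps)
      also have "\<dots> < (2 + b) * m" unfolding wZ(2) using s(2) b by simp
      also have "\<dots> \<le> (2 + b) * (r / (2 + b))" using b by (intro mult_left_mono) (auto simp: m_def)
      also have "\<dots> = r" using b by simp
      finally have "inner (C k) ((w, g w) - X k) \<le> e * norm ((w, g w) - X k)" by (rule r)
      also have "\<dots> \<le> e * ((2 + b) * norm (w - Z k))" using full e by (intro mult_left_mono) auto
      also have "inner (C k) ((w, g w) - X k) = inner y (w - Z k) - inner (V k) R"
        using A'[of "w - Z k" "V k"]
        by (simp add: C' X' y_def R_def inner_diff_left inner_diff_right inner_commute)
      finally have "inner y (w - Z k) \<le> e * ((2 + b) * norm (w - Z k)) + inner (V k) R" by simp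
      also have "inner (V k) R \<le> norm (V k) * (e * norm (w - Z k))"
        using norm_cauchy_schwarz[of "V k" R] R mult_left_mono[OF R norm_ge_zero, of "V k"] by linarith
      also have "inner y (w - Z k) = s * (norm y)\<^sup>2" by (simp add: wZ(1) dot_square_norm)
      also have "e * ((2 + b) * norm (w - Z k)) + norm (V k) * (e * norm (w - Z k))
          = s * (e * (2 + b + norm (V k)) * norm y)"
        unfolding wZ(2) by (simp add: algebra_simps)
      \<comment> \<open>Both sides carry the factor \<open>s\<close>; once it is cancelled, dividing
        by \<open>norm y\<close> gives the bound.\<close>
      finally have "(norm y)\<^sup>2 \<le> e * (2 + b + norm (V k)) * norm y"
        using s(1) by (simp only: mult_le_cancel_left_pos)
      moreover have "0 \<le> e * (2 + b + norm (V k))" using e b by simp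
      ultimately show ?thesis
        unfolding y_def[symmetric] by (cases "y = 0") (simp_all add: power2_eq_square)
    qed
    with ev have le: "\<forall>\<^sub>F k in sequentially. norm (P k - A' (V k)) \<le> e * (2 + b + norm (V k))"
      by (rule eventually_mono)
    have "(\<lambda>k. A' (V k)) \<longlonglongrightarrow> A' v"
      using isCont_tendsto_compose[OF linear_continuous_at lims(3), of A'] A'lin
      by (simp add: linear_conv_bounded_linear)
    with lims(2) have lhs: "(\<lambda>k. norm (P k - A' (V k))) \<longlonglongrightarrow> norm (a - A' v)"
      by (intro tendsto_norm tendsto_diff)
    have rhs: "(\<lambda>k. e * (2 + b + norm (V k))) \<longlonglongrightarrow> e * (2 + b + norm v)"
      by (intro tendsto_intros lims)
    show ?thesis by (rule tendsto_le[OF trivial_limit_sequentially rhs lhs le])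
  qed
  have pos: "0 < 2 + b + norm v" using b by (simp add: add_pos_nonneg)
  have "norm (a - A' v) \<le> 0 + e" if "e > 0" for e
  proof -
    \<comment> \<open>The minimum with 1 meets the restriction \<open>e \<le> 1\<close> in
      \<open>bound\<close>.\<close>
    have "norm (a - A' v) \<le> min 1 (e / (2 + b + norm v)) * (2 + b + norm v)"
      using pos that by (intro bound) auto
    also have "\<dots> \<le> e / (2 + b + norm v) * (2 + b + norm v)" using pos by (intro mult_right_mono) auto
    also have "\<dots> = e" using pos by simp
    finally show ?thesis by simp
  qed
  then have "norm (a - A' v) \<le> 0" by (rule field_le_epsilon)
  then show ?thesis by simp
qed

section \<open>Normals to a calm constraint system\<close>

lemma locally_lipschitz_continuous_on:
  assumes "locally_lipschitz g"
  shows "continuous_on X g"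
proof (rule continuous_at_imp_continuous_on, rule ballI)
  fix x
  obtain U L where "open U" "x \<in> U" "L-lipschitz_on U g"
    using assms unfolding locally_lipschitz_def by blast
  then show "isCont g x"
    using lipschitz_on_continuous_on continuous_on_eq_continuous_at by blast
qed

text \<open>Calmness bounds the distance to the constraint set by the size of the perturbation
  \<open>(u, v)\<close>. The Lipschitz property extends this bound to the decoupled copies, which is
  the hypothesis \<open>subreg\<close> of \<open>limiting_normal_cone_Int_kernel\<close>; the
  product rule then separates the three normals.\<close>

theorem limiting_normal_cone_calm_constraint:
  fixes f :: "'a::euclidean_space \<times> 'b::euclidean_space \<Rightarrow> 'c::euclidean_space"
  assumes lip: "locally_lipschitz f" and "closed C" "closed D"
    and calm: "calm (\<lambda>(u, v). {(x, y) \<in> C. (x + u, f (x, y) + v) \<in> D}) (0, 0) z0"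
    and z0: "z0 \<in> C" "(fst z0, f z0) \<in> D"
    and c: "c \<in> limiting_normal_cone z0 {z \<in> C. (fst z, f z) \<in> D}"
  shows "\<exists>u v a. (u, v) \<in> limiting_normal_cone (fst z0, f z0) D \<and>
    a \<in> fun_coderivative f z0 v \<and> c - (u, 0) - a \<in> limiting_normal_cone z0 C"
proof -
  define \<Omega> where "\<Omega> = {z \<in> C. (fst z, f z) \<in> D}"
  define F where "F = gph (\<lambda>z. {f z})"
  define A where "A = C \<times> F \<times> D"
  define i where "i z = (z, (z, f z), (fst z, f z))" for z
  define T :: "('a \<times> 'b) \<times> (('a \<times> 'b) \<times> 'c) \<times> ('a \<times> 'c) \<Rightarrow> ('a \<times> 'c) \<times> ('a \<times> 'b)"
    where "T p = (case p of (z, (w, t), (u, v)) \<Rightarrow> ((u - fst z, v - t), w - z))" for p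
  define T' :: "('a \<times> 'c) \<times> ('a \<times> 'b) \<Rightarrow> ('a \<times> 'b) \<times> (('a \<times> 'b) \<times> 'c) \<times> ('a \<times> 'c)"
    where "T' q = (case q of ((r, s), b) \<Rightarrow> (- (r, 0) - b, (b, - s), (r, s)))" for q
  have "linear T" by (rule linearI) (auto simp: T_def algebra_simps)
  then have T: "bounded_linear T" by (simp add: linear_conv_bounded_linear)
  then obtain B where B: "B > 0" "\<And>p. norm (T p) \<le> norm p * B"
    using bounded_linear.pos_bounded by blast
  have T': "inner (T p) q = inner p (T' q)" for p q
    by (cases p; cases q) (auto simp: T_def T'_def inner_simps inner_prod_def)
  have cont: "continuous_on X f" for X using lip by (rule locally_lipschitz_continuous_on)
  have "F = {p. f (fst p) = snd p}" by (auto simp: F_def gph_def)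
  then have "closed F"
    by (simp only:) (intro closed_Collect_eq continuous_on_compose2[OF cont[of UNIV]] continuous_intros; simp)
  then have "closed A" unfolding A_def using \<open>closed C\<close> \<open>closed D\<close> by (intro closed_Times)
  have "closed ((\<lambda>z. (fst z, f z)) -` D)"
    by (intro closed_vimage \<open>closed D\<close> continuous_intros cont)
  then have "closed (C \<inter> (\<lambda>z. (fst z, f z)) -` D)" using \<open>closed C\<close> by blast
  moreover have "\<Omega> = C \<inter> (\<lambda>z. (fst z, f z)) -` D" by (auto simp: \<Omega>_def)
  ultimately have "closed \<Omega>" by simp
  have "z0 \<in> \<Omega>" using z0 by (simp add: \<Omega>_def)
  have ker: "{p \<in> A. T p = 0} = i ` \<Omega>"
    by (auto simp: A_def T_def i_def F_def gph_def \<Omega>_def zero_prod_def image_iff)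
  have normal: "(c, 0, 0) \<in> limiting_normal_cone (i z0) {p \<in> A. T p = 0}"
  proof -
    obtain X K where X: "\<And>k::nat. X k \<in> \<Omega>" "X \<longlonglongrightarrow> z0"
      and K: "\<And>k. K k \<in> frechet_normal_cone (X k) \<Omega>" "K \<longlonglongrightarrow> c"
      using c unfolding limiting_normal_cone_def \<Omega>_def by blast
    have "(K k, 0, 0) \<in> frechet_normal_cone (i (X k)) (i ` \<Omega>)" for k
      unfolding frechet_normal_cone_iff
    proof (intro allI impI)
      fix e :: real assume "e > 0"
      then obtain d where "d > 0" and d: "\<And>z. z \<in> \<Omega> \<Longrightarrow> norm (z - X k) < d \<Longrightarrow>
          inner (K k) (z - X k) \<le> e * norm (z - X k)"
        using K(1)[of k, unfolded frechet_normal_cone_iff] by blast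
      have "inner (K k, 0, 0) (i z - i (X k)) \<le> e * norm (i z - i (X k))"
        if "z \<in> \<Omega>" "norm (i z - i (X k)) < d" for z
      proof -
        have le: "norm (z - X k) \<le> norm (i z - i (X k))"
          using norm_fst_le[of "fst (i z - i (X k))" "snd (i z - i (X k))"] by (simp add: i_def)
        have "inner (K k) (z - X k) \<le> e * norm (z - X k)" using d that le by simp
        also have "\<dots> \<le> e * norm (i z - i (X k))" using le \<open>e > 0\<close> by simp
        finally show ?thesis by (simp add: i_def)
      qed
      then show "\<exists>d>0. \<forall>p\<in>i ` \<Omega>. norm (p - i (X k)) < d \<longrightarrow>
          inner (K k, 0, 0) (p - i (X k)) \<le> e * norm (p - i (X k))"
        using \<open>d > 0\<close> by blast
    qed
    moreover have "(\<lambda>k. i (X k)) \<longlonglongrightarrow> i z0"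
      unfolding i_def using X(2) continuous_on_tendsto_compose[OF cont[of UNIV] X(2)]
      by (intro tendsto_intros) auto
    moreover have "(\<lambda>k. (K k, 0::('a \<times> 'b) \<times> 'c, 0::'a \<times> 'c)) \<longlonglongrightarrow> (c, 0, 0)"
      by (intro tendsto_intros K)
    ultimately show ?thesis
      unfolding ker limiting_normal_cone_def mem_Collect_eq using X(1)
      by (intro exI[of _ "\<lambda>k. i (X k)"] exI[of _ "\<lambda>k. (K k, 0, 0)"]) auto
  qed
  obtain U L where U: "open U" "z0 \<in> U" and L: "L-lipschitz_on U f"
    using lip unfolding locally_lipschitz_def by blast
  have "L \<ge> 0" using L by (rule lipschitz_on_nonneg)
  obtain r1 where "r1 > 0" and r1: "ball z0 r1 \<subseteq> U" using U open_contains_ball by blast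
  have Ldist: "norm (f w - f z) \<le> L * norm (w - z)" if "norm (w - z0) < r1" "norm (z - z0) < r1" for w z
    using lipschitz_on_normD[OF L, of w z] subsetD[OF r1, of w] subsetD[OF r1, of z] that
    by (simp add: dist_norm norm_minus_commute)
  define \<Psi> where "\<Psi> = (\<lambda>(u, v). {(x, y) \<in> C. (x + u, f (x, y) + v) \<in> D})"
  have \<Psi>0: "\<Psi> (0, 0) = \<Omega>" by (auto simp: \<Psi>_def \<Omega>_def)
  obtain W V l where W: "open W" "(0, 0) \<in> W" and V: "open V" "z0 \<in> V" and "l > 0"
    and l': "\<forall>s\<in>W. \<forall>z \<in> V \<inter> \<Psi> s. \<Omega> \<noteq> {} \<and> infdist z \<Omega> \<le> l * norm (s - (0, 0))"
    using calm unfolding calm_def \<Psi>_def[symmetric] \<Psi>0 by blast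
  have l: "infdist z \<Omega> \<le> l * norm (u, v)"
    if "(u, v) \<in> W" "z \<in> V" "z \<in> C" "(fst z + u, f z + v) \<in> D" for u v z
  proof -
    have "z \<in> V \<inter> \<Psi> (u, v)" using that by (cases z) (simp add: \<Psi>_def)
    then show ?thesis using l' that(1) by fastforce
  qed
  obtain r2 where "r2 > 0" and r2: "ball (0, 0) r2 \<subseteq> W" using W open_contains_ball by blast
  obtain r3 where "r3 > 0" and r3: "ball z0 r3 \<subseteq> V" using V open_contains_ball by blast
  \<comment> \<open>In this order the bounds serve the Lipschitz estimate at points within
    \<open>2 * \<rho>\<close> of \<open>z0\<close>, membership of the perturbation in
    \<open>W\<close>, and membership of \<open>z\<close> in \<open>V\<close>.\<close>
  define \<rho> where "\<rho> = min (r1 / 2) (min (r2 / ((1 + L) * B)) r3)"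
  have LB: "(1 + L) * B > 0" using \<open>L \<ge> 0\<close> B by simp
  have "\<rho> > 0" using \<open>r1 > 0\<close> \<open>r2 > 0\<close> \<open>r3 > 0\<close> LB by (simp add: \<rho>_def)
  \<comment> \<open>With \<open>n = norm (T p)\<close> and \<open>m\<close> the distance from
    \<open>z\<close> to \<open>\<Omega>\<close>, the components of \<open>p - i z'\<close> add up to
    at most \<open>(3 + 2 * L) * (n + m)\<close>, and calmness gives
    \<open>m \<le> l * ((1 + L) * n)\<close>.\<close>
  define M where "M = (3 + 2 * L) * (1 + l * (1 + L))"
  have "M \<ge> 0" using \<open>L \<ge> 0\<close> \<open>l > 0\<close> by (simp add: M_def)
  have "\<exists>q. (c, 0, 0) - T' q \<in> limiting_normal_cone (i z0) A"
  proof (rule limiting_normal_cone_Int_kernel[OF \<open>closed A\<close> T T' \<open>\<rho> > 0\<close> \<open>M \<ge> 0\<close> _ normal])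
    fix p assume p: "p \<in> A" "norm (p - i z0) < \<rho>"
    obtain z w t u v where p_eq: "p = (z, (w, t), (u, v))" by (metis surj_pair)
    have mem: "z \<in> C" "t = f w" "(u, v) \<in> D"
      using p(1) by (auto simp: p_eq A_def F_def gph_def)
    have pz: "norm (z - z0) \<le> norm (p - i z0)"
      using norm_fst_le[of "fst (p - i z0)" "snd (p - i z0)"] by (simp add: p_eq i_def)
    have pw: "norm (w - z0) \<le> norm (p - i z0)"
      using norm_fst_le[of "w - z0" "t - f z0"]
        norm_fst_le[of "(w, t) - (z0, f z0)" "(u, v) - (fst z0, f z0)"]
        norm_snd_le[of "snd (p - i z0)" "fst (p - i z0)"] by (simp add: p_eq i_def)
    define n where "n = norm (T p)"
    have Tp: "T p = ((u - fst z, v - t), w - z)" by (simp add: p_eq T_def)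
    have nw: "norm (w - z) \<le> n" and nuv: "norm (u - fst z, v - t) \<le> n"
      using norm_fst_le[of "fst (T p)" "snd (T p)"] norm_snd_le[of "snd (T p)" "fst (T p)"] by (simp_all add: Tp n_def)
    have nu: "norm (u - fst z) \<le> n" and nv: "norm (v - t) \<le> n"
      using nuv norm_fst_le[of "u - fst z" "v - t"] norm_snd_le[of "v - t" "u - fst z"] by simp_all
    have close: "norm (z - z0) < \<rho>" "norm (w - z0) < \<rho>" using pz pw p by simp_all
    have r1': "\<rho> < r1" using \<open>r1 > 0\<close> by (simp add: \<rho>_def)
    \<comment> \<open>Calmness perturbs around \<open>f z\<close>, whereas \<open>T p\<close>
      measures against \<open>t = f w\<close>; the exchange costs
      \<open>L * norm (w - z)\<close>.\<close>
    have "norm (u - fst z, v - f z) \<le> norm (u - fst z, v - t) + norm (0::'a, f w - f z)"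
      using norm_triangle_ineq[of "(u - fst z, v - t)" "(0, f w - f z)"] by (simp add: mem)
    also have "\<dots> \<le> n + L * n"
      using nuv Ldist[of w z] close r1' mult_left_mono[OF nw \<open>L \<ge> 0\<close>] by (simp add: norm_Pair)
    finally have pert: "norm (u - fst z, v - f z) \<le> (1 + L) * n" by (simp add: algebra_simps)
    have "T p = T (p - i z0)"
      using linear_diff[OF \<open>linear T\<close>, of p "i z0"] by (simp add: T_def i_def zero_prod_def)
    then have "n \<le> norm (p - i z0) * B" using B(2)[of "p - i z0"] by (simp add: n_def)
    also have "\<dots> < \<rho> * B" using p B(1) by simp
    finally have "(1 + L) * n < (1 + L) * (\<rho> * B)" using \<open>L \<ge> 0\<close> by simp
    also have "\<dots> = ((1 + L) * B) * \<rho>" by simp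
    also have "\<dots> \<le> ((1 + L) * B) * (r2 / ((1 + L) * B))"
      using LB by (intro mult_left_mono) (auto simp: \<rho>_def)
    also have "\<dots> = r2" using LB by (metis less_irrefl nonzero_mult_div_cancel_left times_divide_eq_right)
    finally have "(u - fst z, v - f z) \<in> W" "z \<in> V"
      using pert close subsetD[OF r2, of "(u - fst z, v - f z)"] subsetD[OF r3, of z]
      by (simp_all add: dist_norm norm_minus_commute \<rho>_def norm_Pair)
    then have "infdist z \<Omega> \<le> l * norm (u - fst z, v - f z)" using l mem by simp
    also have "\<dots> \<le> l * ((1 + L) * n)" using pert \<open>l > 0\<close> by simp
    finally have inf: "infdist z \<Omega> \<le> l * ((1 + L) * n)" .
    \<comment> \<open>A nearest point of \<open>\<Omega>\<close> supplies the kernel point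
      \<open>i z'\<close>.\<close>
    obtain z' where z': "z' \<in> \<Omega>" "infdist z \<Omega> = dist z z'"
      using infdist_attains_inf[OF \<open>closed \<Omega>\<close>] \<open>z0 \<in> \<Omega>\<close> by blast
    define m where "m = norm (z - z')"
    have m: "m \<le> l * ((1 + L) * n)" using inf z'(2) by (simp add: m_def dist_norm)
    \<comment> \<open>Since \<open>z0\<close> itself competes for the distance, \<open>z'\<close>
      stays within \<open>2 * \<rho>\<close> of \<open>z0\<close>, where \<open>Ldist\<close> is
      available.\<close>
    have "m < \<rho>" using infdist_le[OF \<open>z0 \<in> \<Omega>\<close>, of z] z'(2) close by (simp add: m_def dist_norm)
    then have "norm (z' - z0) < \<rho> + \<rho>"
      using close norm_triangle_ineq[of "z' - z" "z - z0"] by (simp add: m_def norm_minus_commute)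
    also have "\<dots> \<le> r1" by (simp add: \<rho>_def)
    finally have z'r: "norm (z' - z0) < r1" .
    have w': "norm (w - z') \<le> n + m"
      using nw norm_triangle_ineq[of "w - z" "z - z'"] by (simp add: m_def)
    have f': "norm (f w - f z') \<le> L * (n + m)"
      using Ldist[of w z'] close r1' z'r mult_left_mono[OF w' \<open>L \<ge> 0\<close>] by simp
    have v': "norm (v - f z') \<le> n + L * (n + m)"
      using f' nv norm_triangle_ineq[of "v - t" "f w - f z'"] by (simp add: mem)
    have u': "norm (u - fst z') \<le> n + m"
      using nu norm_triangle_ineq[of "u - fst z" "fst z - fst z'"]
        norm_fst_le[of "fst (z - z')" "snd (z - z')", unfolded prod.collapse m_def[symmetric]]
      by simp
    have "norm (p - i z') = norm (z - z', (w - z', f w - f z'), (u - fst z', v - f z'))"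
      by (simp add: p_eq i_def mem)
    also have "\<dots> \<le> m + ((norm (w - z') + norm (f w - f z')) + (norm (u - fst z') + norm (v - f z')))"
      unfolding m_def by (intro order_trans[OF norm_Pair_le] add_mono order_refl norm_Pair_le)
    also have "\<dots> \<le> m + ((n + m + L * (n + m)) + (n + m + (n + L * (n + m))))"
      using w' f' u' v' by (intro add_mono) auto
    also have "\<dots> = (3 + 2 * L) * (n + m)" by (simp add: algebra_simps)
    also have "\<dots> \<le> (3 + 2 * L) * (n + l * ((1 + L) * n))"
      using m \<open>L \<ge> 0\<close> by (intro mult_left_mono) auto
    also have "\<dots> = M * norm (T p)" by (simp add: M_def n_def algebra_simps)
    finally have "norm (p - i z') \<le> M * norm (T p)" .
    moreover have "i z' \<in> {p \<in> A. T p = 0}" using z'(1) by (simp add: ker)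
    ultimately show "\<exists>p'\<in>A. T p' = 0 \<and> norm (p - p') \<le> M * norm (T p)" by blast
  qed
  then obtain q where q: "(c, 0, 0) - T' q \<in> limiting_normal_cone (i z0) A" ..
  obtain r s b where q_eq: "q = ((r, s), b)" by (metis surj_pair)
  \<comment> \<open>The blocks of the multiplier \<open>q\<close> become the normals:
    \<open>b\<close> couples the copies \<open>z\<close> and \<open>w\<close>, while
    \<open>r\<close> and \<open>s\<close> couple \<open>(u, v)\<close> to \<open>fst z\<close> and
    \<open>t\<close>.\<close>
  have *: "(c + (r, 0) + b, (- b, s), (- r, - s)) \<in> limiting_normal_cone (z0, (z0, f z0), (fst z0, f z0)) (C \<times> F \<times> D)"
  proof -
    have "(c, 0, 0) - T' q = (c + (r, 0) + b, (- b, s), (- r, - s))"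
      by (cases c; cases b) (simp add: q_eq T'_def)
    then show ?thesis using q unfolding i_def A_def by simp
  qed
  show ?thesis
  proof (intro exI conjI)
    show "(- r, - s) \<in> limiting_normal_cone (fst z0, f z0) D"
      using limiting_normal_cone_TimesD(2)[OF limiting_normal_cone_TimesD(2)[OF *]] .
    show "- b \<in> fun_coderivative f z0 (- s)"
      using limiting_normal_cone_TimesD(1)[OF limiting_normal_cone_TimesD(2)[OF *]]
      by (simp add: fun_coderivative_def coderivative_def F_def)
    have "c - (- r, 0) - - b = c + (r, 0) + b" by (cases c) simp
    then show "c - (- r, 0) - - b \<in> limiting_normal_cone z0 C"
      using limiting_normal_cone_TimesD(1)[OF *] by (simp only:)
  qed
qed

section \<open>Jacobians and the adjoint of the strict derivative\<close>

lemma inner_transpose_matrix: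
  fixes B :: "real ^ 'n \<Rightarrow> real ^ 'q"
  assumes "linear B"
  shows "inner x (transpose (matrix B) *v v) = inner (B x) v"
  using dot_lmul_matrix[of v "matrix B" x] fun_cong[OF matrix_vector_mul(2)[OF assms], of x]
  by (simp add: inner_commute)

lemma strictly_differentiable_imp_has_derivative:
  fixes g :: "'a::euclidean_space \<Rightarrow> 'b::euclidean_space"
  assumes lim: "((\<lambda>(w, z). (g w - g z - A (w - z)) /\<^sub>R norm (w - z)) \<longlongrightarrow> 0)
         (at (x, x) within {(w, z). w \<noteq> z})"
    and A: "bounded_linear A"
  shows "(g has_derivative A) (at x)"
  unfolding has_derivative_at_alt
proof (intro conjI A allI impI)
  fix e :: real assume "0 < e"
  from strictly_differentiable_at_estimate[OF lim bounded_linear.linear[OF A] this]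
  obtain d where "d > 0" and d: "\<And>w z. norm (w - x) < d \<Longrightarrow> norm (z - x) < d \<Longrightarrow>
      norm (g w - g z - A (w - z)) \<le> e * norm (w - z)" by blast
  from d[of _ x] \<open>d > 0\<close>
  show "\<exists>d>0. \<forall>y. norm (y - x) < d \<longrightarrow> norm (g y - g x - A (y - x)) \<le> e * norm (y - x)"
    by (intro exI[of _ d]) simp
qed

text \<open>The strict derivative splits as \<open>A (p, h) = A (p, 0) + A (0, h)\<close>, and its
  two parts are the partial derivatives. The adjoint is therefore the pair of transposed partial
  Jacobians.\<close>

lemma fun_coderivative_jacobian:
  fixes f :: "(real ^ 'n) \<times> (real ^ 'm) \<Rightarrow> real ^ 'q"
  assumes "strictly_differentiable_at f (x, y)" "(a, b) \<in> fun_coderivative f (x, y) v"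
  shows "a = transpose (jacobian (\<lambda>x. f (x, y)) (at x)) *v v"
    and "b = transpose (jacobian (\<lambda>y. f (x, y)) (at y)) *v v"
proof -
  obtain A where A: "bounded_linear A"
    and lim: "((\<lambda>(w, z). (f w - f z - A (w - z)) /\<^sub>R norm (w - z)) \<longlongrightarrow> 0)
         (at ((x, y), (x, y)) within {(w, z). w \<noteq> z})"
    using assms(1) unfolding strictly_differentiable_at_def by blast
  have der: "(f has_derivative A) (at (x, y))"
    using strictly_differentiable_imp_has_derivative[OF lim A] .
  have "((\<lambda>x. f (x, y)) has_derivative (\<lambda>h. A (h, 0))) (at x)"
    by (rule has_derivative_compose[where f = "\<lambda>x. (x, y)", OF _ der]) (auto intro!: derivative_eq_intros)
  then have jx: "jacobian (\<lambda>x. f (x, y)) (at x) = matrix (\<lambda>h. A (h, 0))" "linear (\<lambda>h. A (h, 0))"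
    by (auto simp: jacobian_def dest: frechet_derivative_at has_derivative_linear)
  have "((\<lambda>y. f (x, y)) has_derivative (\<lambda>h. A (0, h))) (at y)"
    by (rule has_derivative_compose[where f = "\<lambda>y. (x, y)", OF _ der]) (auto intro!: derivative_eq_intros)
  then have jy: "jacobian (\<lambda>y. f (x, y)) (at y) = matrix (\<lambda>h. A (0, h))" "linear (\<lambda>h. A (0, h))"
    by (auto simp: jacobian_def dest: frechet_derivative_at has_derivative_linear)
  have A': "inner (A u) w = inner u (transpose (jacobian (\<lambda>x. f (x, y)) (at x)) *v w,
      transpose (jacobian (\<lambda>y. f (x, y)) (at y)) *v w)" for u w
  proof (cases u)
    case (Pair p h)
    have "A (p, h) = A (p, 0) + A (0, h)"
      using linear_add[OF bounded_linear.linear[OF A], of "(p, 0)" "(0, h)"] by simp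
    then have "inner (A (p, h)) w = inner (A (p, 0)) w + inner (A (0, h)) w"
      by (simp only: inner_add_left)
    then show ?thesis
      by (simp add: Pair jx(1) jy(1) inner_transpose_matrix[OF jx(2)] inner_transpose_matrix[OF jy(2)]
          del: transpose_matrix_vector)
  qed
  from fun_coderivative_strictly_differentiable[OF lim A A' assms(2)]
  show "a = transpose (jacobian (\<lambda>x. f (x, y)) (at x)) *v v"
    and "b = transpose (jacobian (\<lambda>y. f (x, y)) (at y)) *v v" by simp_all
qed

section \<open>The coderivative of the solution map\<close>

theorem proposition4p3:
  fixes f :: "(real ^ 'n) \<times> (real ^ 'm) \<Rightarrow> real ^ 'q"
    and Y :: "real ^ 'n \<Rightarrow> (real ^ 'm) set"
    and \<Phi> :: "real ^ 'n \<Rightarrow> (real ^ 'q) set"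
    and xb :: "real ^ 'n" and yb :: "real ^ 'm"
  assumes "CARD('q) \<ge> 2"
    and "\<Phi> = frontierE f Y \<or> \<Phi> = frontierW f Y"
    and "(xb, yb) \<in> gph (solution_map f Y \<Phi>)"
    and "locally_lipschitz f"
    and "closed (gph Y)" and "closed (gph \<Phi>)"
    and "GVFCQ f Y \<Phi> xb yb"
  shows "(\<forall>ys :: real ^ 'm.
            coderivative (solution_map f Y \<Phi>) xb yb ys \<subseteq>
            (\<Union>(us, vs) \<in> {(us, vs). us \<in> coderivative \<Phi> xb (f (xb, yb)) (- vs)}.
               \<Union>(as, bs) \<in> fun_coderivative f (xb, yb) vs.
                 (+) (us + as) ` coderivative Y xb yb (ys + bs)))
       \<and> (strictly_differentiable_at f (xb, yb) \<longrightarrow>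
          (\<forall>ys :: real ^ 'm.
            coderivative (solution_map f Y \<Phi>) xb yb ys \<subseteq>
            (\<Union>(us, vs) \<in> {(us, vs). us \<in> coderivative \<Phi> xb (f (xb, yb)) (- vs)}.
               (+) (us + transpose (jacobian (\<lambda>x. f (x, yb)) (at xb)) *v vs) `
                 coderivative Y xb yb
                   (ys + transpose (jacobian (\<lambda>y. f (xb, y)) (at yb)) *v vs))))"
proof -
  \<comment> \<open>In this form the graph is the constraint set of
    \<open>limiting_normal_cone_calm_constraint\<close>, and GVFCQ is exactly its calmness
    hypothesis.\<close>
  have gphS: "gph (solution_map f Y \<Phi>) = {z \<in> gph Y. (fst z, f z) \<in> gph \<Phi>}"
    by (auto simp: gph_def solution_map_def)
  have z0: "(xb, yb) \<in> gph Y" "(fst (xb, yb), f (xb, yb)) \<in> gph \<Phi>"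
    using assms(3) unfolding gphS by auto
  have key: "\<exists>us vs as bs. us \<in> coderivative \<Phi> xb (f (xb, yb)) (- vs) \<and>
      (as, bs) \<in> fun_coderivative f (xb, yb) vs \<and>
      xs - us - as \<in> coderivative Y xb yb (ys + bs)"
    if "xs \<in> coderivative (solution_map f Y \<Phi>) xb yb ys" for xs ys
  proof -
    have "(xs, - ys) \<in> limiting_normal_cone (xb, yb) {z \<in> gph Y. (fst z, f z) \<in> gph \<Phi>}"
      using that by (simp add: coderivative_def gphS)
    from limiting_normal_cone_calm_constraint[OF assms(4,5,6) assms(7)[unfolded GVFCQ_def] z0 this]
    obtain us vs as bs where
      "(us, vs) \<in> limiting_normal_cone (xb, f (xb, yb)) (gph \<Phi>)"
      "(as, bs) \<in> fun_coderivative f (xb, yb) vs"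
      "(xs, - ys) - (us, 0) - (as, bs) \<in> limiting_normal_cone (xb, yb) (gph Y)"
      by auto
    \<comment> \<open>The signs agree: \<open>- (- vs) = vs\<close> in the graph of
      \<open>\<Phi>\<close>, and the second component \<open>- ys - bs\<close> is
      \<open>- (ys + bs)\<close>.\<close>
    then show ?thesis
      by (intro exI[of _ us] exI[of _ vs] exI[of _ as] exI[of _ bs]) (simp add: coderivative_def)
  qed
  have shift: "x \<in> (+) c ` B \<longleftrightarrow> x - c \<in> B" for x c :: "real ^ 'n" and B
    by (force simp: image_iff)
  show ?thesis
  proof (intro conjI allI impI subsetI)
    fix ys xs assume "xs \<in> coderivative (solution_map f Y \<Phi>) xb yb ys"
    from key[OF this] obtain us vs as bs
      where us: "us \<in> coderivative \<Phi> xb (f (xb, yb)) (- vs)"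
        and ab: "(as, bs) \<in> fun_coderivative f (xb, yb) vs"
        and "xs - us - as \<in> coderivative Y xb yb (ys + bs)" by blast
    then have xs: "xs \<in> (+) (us + as) ` coderivative Y xb yb (ys + bs)"
      by (simp only: shift diff_diff_eq)
    show "xs \<in> (\<Union>(us, vs) \<in> {(us, vs). us \<in> coderivative \<Phi> xb (f (xb, yb)) (- vs)}.
               \<Union>(as, bs) \<in> fun_coderivative f (xb, yb) vs.
                 (+) (us + as) ` coderivative Y xb yb (ys + bs))"
      by (rule UN_I[of "(us, vs)"], use us in simp, unfold prod.case, rule UN_I[OF ab], unfold prod.case, rule xs)
  next
    fix ys xs
    assume diff: "strictly_differentiable_at f (xb, yb)"
      and "xs \<in> coderivative (solution_map f Y \<Phi>) xb yb ys"
    from key[OF this(2)] obtain us vs as bs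
      where us: "us \<in> coderivative \<Phi> xb (f (xb, yb)) (- vs)"
        and ab: "(as, bs) \<in> fun_coderivative f (xb, yb) vs"
        and "xs - us - as \<in> coderivative Y xb yb (ys + bs)" by blast
    then have xs: "xs \<in> (+) (us + as) ` coderivative Y xb yb (ys + bs)"
      by (simp only: shift diff_diff_eq)
    show "xs \<in> (\<Union>(us, vs) \<in> {(us, vs). us \<in> coderivative \<Phi> xb (f (xb, yb)) (- vs)}.
               (+) (us + transpose (jacobian (\<lambda>x. f (x, yb)) (at xb)) *v vs) `
                 coderivative Y xb yb
                   (ys + transpose (jacobian (\<lambda>y. f (xb, y)) (at yb)) *v vs))"
      \<comment> \<open>Strict differentiability forces \<open>as\<close> and \<open>bs\<close> to
        be the transposed Jacobians applied to \<open>vs\<close>, so the inner union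
        disappears.\<close>
      by (rule UN_I[of "(us, vs)"], use us in simp, unfold prod.case,
          rule xs[unfolded fun_coderivative_jacobian[OF diff ab]])
  qed
qed

end
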